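(* Let $h\ge 1$ be an integer with $h\ne 2$, and let $N_{e_h}$ be the necklace graph. Then $\chi'_{st}(N_{e_h})=5$.
   Context: All graphs are finite and simple. For $k\ge 1$ let $[k]=\{1,2,\dots,k\}$. A star $k$-edge coloring of a graph $G$ is a proper edge-coloring $c:E(G)\to[k]$ such that no path of length four (four edges) and no cycle of length four in $G$ is bi-colored (i.e. uses only two colors) under $c$. The star chromatic index $\chi'_{st}(G)$ is the smallest integer $k$ such that $G$ admits a star $k$-edge coloring. A Halin graph $G=T\cup C$ is a planar graph that consists of a plane embedding of a tree $T$ that has no vertices of degree two, together with a cycle $C$ connecting all the leaves of $T$ such that $C$ is the boundary of the exterior face; $T$ is its characteristic tree. It is a cubic Halin graph if every non-leaf vertex of $T$ has degree exactly $3$. A caterpillar is a tree such that the removal of all its leaves results in a path (the spine). The necklace graph $N_{e_h}$ is the cubic Halin graph whose characteristic tree is a caterpillar with $h+2$ leaves and spine $v_1v_2\cdots v_h$, drawn so that all the edges joining $v_i$ ($2\le i\le h-1$) to its leaf neighbor lie on the same side of the spine. Explicitly, $N_{e_1}=K_4$, and for $h\ge 2$ the graph $N_{e_h}$ has vertices $v_1,\dots,v_h,u_0,u_1,\dots,u_{h+1}$; its edges are $v_iv_{i+1}$ for $1\le i\le h-1$, $u_iv_i$ for $1\le i\le h$, $u_0v_1$, $u_{h+1}v_h$, and the edges of the outer cycle $u_0u_1u_2\cdots u_hu_{h+1}u_0$. *)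

theory Defs
  imports Main
begin

type_synonym 'a graph = "'a set \<times> 'a set set"

abbreviation verts :: "'a graph \<Rightarrow> 'a set" where "verts \<equiv> fst"
abbreviation edges :: "'a graph \<Rightarrow> 'a set set" where "edges \<equiv> snd"

definition finite_simple_graph :: "'a graph \<Rightarrow> bool" where
  "finite_simple_graph G \<longleftrightarrow>
     finite (verts G) \<and> (\<forall>e\<in>edges G. e \<subseteq> verts G \<and> card e = 2)"

text \<open>Paths and cycles are given by their vertex sequences. The closing edge of a cycle
  joins the last vertex to the first one.\<close>

definition path_edges :: "'a list \<Rightarrow> 'a set set" where
  "path_edges xs = {{xs ! i, xs ! Suc i} | i. Suc i < length xs}"

definition cycle_edges :: "'a list \<Rightarrow> 'a set set" where
  "cycle_edges xs = insert {last xs, hd xs} (path_edges xs)"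

definition is_path :: "'a graph \<Rightarrow> 'a list \<Rightarrow> bool" where
  "is_path G xs \<longleftrightarrow>
     xs \<noteq> [] \<and> distinct xs \<and> set xs \<subseteq> verts G \<and> path_edges xs \<subseteq> edges G"

definition is_cycle :: "'a graph \<Rightarrow> 'a list \<Rightarrow> bool" where
  "is_cycle G xs \<longleftrightarrow>
     3 \<le> length xs \<and> distinct xs \<and> set xs \<subseteq> verts G \<and> cycle_edges xs \<subseteq> edges G"

definition proper_edge_coloring :: "'a graph \<Rightarrow> nat \<Rightarrow> ('a set \<Rightarrow> nat) \<Rightarrow> bool" where
  "proper_edge_coloring G k c \<longleftrightarrow>
     c ` edges G \<subseteq> {1..k} \<and>
     (\<forall>e\<in>edges G. \<forall>f\<in>edges G. e \<noteq> f \<and> e \<inter> f \<noteq> {} \<longrightarrow> c e \<noteq> c f)"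

definition bicolored :: "('a set \<Rightarrow> nat) \<Rightarrow> 'a set set \<Rightarrow> bool" where
  "bicolored c F \<longleftrightarrow> card (c ` F) = 2"

text \<open>Lengths count edges, so a path of length four has five vertices.\<close>

definition star_edge_coloring :: "'a graph \<Rightarrow> nat \<Rightarrow> ('a set \<Rightarrow> nat) \<Rightarrow> bool" where
  "star_edge_coloring G k c \<longleftrightarrow>
     proper_edge_coloring G k c \<and>
     (\<forall>xs. is_path G xs \<and> length xs = 5 \<longrightarrow> \<not> bicolored c (path_edges xs)) \<and>
     (\<forall>xs. is_cycle G xs \<and> length xs = 4 \<longrightarrow> \<not> bicolored c (cycle_edges xs))"

definition star_chromatic_index :: "'a graph \<Rightarrow> nat" where
  "star_chromatic_index G = (LEAST k. 1 \<le> k \<and> (\<exists>c. star_edge_coloring G k c))"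

datatype necklace_vertex = V nat | U nat

text \<open>Intended for \<open>h \<ge> 1\<close>. For \<open>h = 1\<close> the general description already gives the complete
  graph on the four vertices \<open>V 1, U 0, U 1, U 2\<close>; see \<open>necklace_1_complete\<close> below.\<close>

definition necklace :: "nat \<Rightarrow> necklace_vertex graph" where
  "necklace h =
    (V ` {1..h} \<union> U ` {0..h+1},
     {{V i, V (i+1)} | i. 1 \<le> i \<and> i < h} \<union>
     {{U i, V i} | i. 1 \<le> i \<and> i \<le> h} \<union>
     {{U 0, V 1}, {U (h+1), V h}} \<union>
     {{U i, U (i+1)} | i. i \<le> h} \<union>
     {{U (h+1), U 0}})"

lemma necklace_finite_simple:
  assumes "1 \<le> h"
  shows "finite_simple_graph (necklace h)"
  using assms unfolding finite_simple_graph_def necklace_def fst_conv snd_conv ball_Un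
  by (intro conjI) auto

lemma necklace_1_complete:
  "card (verts (necklace 1)) = 4"
  "edges (necklace 1) = {e. e \<subseteq> verts (necklace 1) \<and> card e = 2}"
proof -
  have v: "verts (necklace 1) = {V 1, U 0, U 1, U 2}"
  proof -
    have "{0..1 + 1} = {0, 1, 2::nat}" by auto
    then show ?thesis by (auto simp: necklace_def)
  qed
  show "card (verts (necklace 1)) = 4"
    unfolding v by simp
  have e: "edges (necklace 1) =
      {{U 1, V 1}, {U 0, V 1}, {U 2, V 1}, {U 0, U 1}, {U 1, U 2}, {U 2, U 0}}"
  proof -
    have a: "{{V i, V (i+1)} | i::nat. 1 \<le> i \<and> i < 1} = {}" by auto
    have b: "{{U i, V i} | i::nat. 1 \<le> i \<and> i \<le> 1} = {{U 1, V 1}}"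
      by (auto intro!: exI[of _ 1] dest: le_antisym)
    have c: "{{U i, U (i+1)} | i::nat. i \<le> 1} = {{U 0, U 1}, {U 1, U 2}}"
    proof -
      have "{{U i, U (i+1)} | i::nat. i \<le> 1} = (\<lambda>i. {U i, U (i+1)}) ` {i. i \<le> 1}"
        by blast
      also have "{i::nat. i \<le> 1} = {0, 1}" by auto
      finally show ?thesis by (simp add: numeral_2_eq_2)
    qed
    show ?thesis
      unfolding necklace_def snd_conv a b c one_add_one Un_insert_left Un_empty_left
      by (simp only: insert_commute)
  qed
  show "edges (necklace 1) = {e. e \<subseteq> verts (necklace 1) \<and> card e = 2}"
  proof (intro equalityI subsetI)
    fix x assume "x \<in> edges (necklace 1)"
    then show "x \<in> {e. e \<subseteq> verts (necklace 1) \<and> card e = 2}"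
      unfolding e v by (elim insertE) simp_all
  next
    fix x assume "x \<in> {e. e \<subseteq> verts (necklace 1) \<and> card e = 2}"
    then obtain a b where "x = {a, b}" "a \<noteq> b" "a \<in> verts (necklace 1)" "b \<in> verts (necklace 1)"
      by (auto simp: card_2_iff)
    then show "x \<in> edges (necklace 1)"
      unfolding e v by (elim insertE) (simp_all add: insert_commute)
  qed
qed

end

theory Submission
  imports Defs
begin

text \<open>Lower bound. The vertices \<open>u\<^sub>0, u\<^sub>1, v\<^sub>1\<close> form a triangle, and each has one further edge,
  its pendant. With four colors, a pendant is colored either like the opposite side of the
  triangle or with the fourth color. Two pendants colored like their opposite sides would be the
  ends of an alternating walk through the triangle, so at least two pendants carry the fourth
  color (\<open>two_pendants_agree\<close>). For \<open>h = 1\<close> the pendants meet in one vertex, and this contradicts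
  properness. For \<open>h \<ge> 2\<close> their outer ends branch, and two equal pendants force the colors on the
  branches until some vertex has two equally colored edges (\<open>pendants_differ\<close>).

  Upper bound. The star condition is local: for two edges at a common vertex it compares their
  colors with the palettes (the sets of incident colors) of their other ends
  (\<open>star_edge_coloringI\<close>). The necklace is a ladder whose rungs are the edges \<open>u\<^sub>iv\<^sub>i\<close> and whose
  rails are \<open>u\<^sub>0u\<^sub>1\<dots>u\<^sub>h\<^sub>+\<^sub>1\<close> and \<open>u\<^sub>0v\<^sub>1\<dots>v\<^sub>hu\<^sub>h\<^sub>+\<^sub>1\<close>; at both ends the rails meet, and the edge
  \<open>u\<^sub>0u\<^sub>h\<^sub>+\<^sub>1\<close> acts as the rung there. A coloring thus becomes a sequence of columns constrained
  in windows of four and at the two ends (\<open>star_edge_coloring_ladder\<close>). There is a period of four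
  columns that may be inserted near the left end without violating a constraint
  (\<open>ladder_ok_insert_block\<close>), so explicit colorings for \<open>h = 3, 4, 5, 6\<close> give one for every
  \<open>h \<ge> 3\<close>, and \<open>h = 1\<close> has its own.\<close>

section \<open>Palettes and a local criterion\<close>

text \<open>Two edges of colors \<open>p\<close> and \<open>q\<close> meet in a vertex, and \<open>P\<close> and \<open>Q\<close> are the palettes of their
  other ends. The two edges are the middle of an alternating walk with four edges precisely if
  color \<open>q\<close> is available beyond the first and color \<open>p\<close> beyond the second.\<close>

definition compatible :: "nat \<Rightarrow> nat set \<Rightarrow> nat \<Rightarrow> nat set \<Rightarrow> bool" where
  "compatible p P q Q \<longleftrightarrow> p \<noteq> q \<and> \<not> (q \<in> P \<and> p \<in> Q)"

lemma compatible_sym: "compatible p P q Q \<Longrightarrow> compatible q Q p P"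
  by (auto simp: compatible_def)

lemma path_edges_simps [simp]:
  "path_edges [x] = {}"
  "path_edges (x # y # xs) = insert {x, y} (path_edges (y # xs))"
proof -
  show "path_edges [x] = {}" by (simp add: path_edges_def)
  show "path_edges (x # y # xs) = insert {x, y} (path_edges (y # xs))"
    unfolding path_edges_def
  proof (intro equalityI subsetI)
    fix e assume "e \<in> {{(x # y # xs) ! i, (x # y # xs) ! Suc i} |i. Suc i < length (x # y # xs)}"
    then obtain i where i: "e = {(x # y # xs) ! i, (x # y # xs) ! Suc i}"
      "Suc i < length (x # y # xs)" by blast
    then show "e \<in> insert {x, y} {{(y # xs) ! i, (y # xs) ! Suc i} |i. Suc i < length (y # xs)}"
      by (cases i) auto
  next
    fix e assume "e \<in> insert {x, y} {{(y # xs) ! i, (y # xs) ! Suc i} |i. Suc i < length (y # xs)}"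
    then consider "e = {x, y}"
      | i where "e = {(y # xs) ! i, (y # xs) ! Suc i}" "Suc i < length (y # xs)" by blast
    then show "e \<in> {{(x # y # xs) ! i, (x # y # xs) ! Suc i} |i. Suc i < length (x # y # xs)}"
    proof cases
      case 1 then show ?thesis by (intro CollectI exI[of _ 0]) simp
    next
      case (2 i) then show ?thesis by (intro CollectI exI[of _ "Suc i"]) simp
    qed
  qed
qed

lemma alternating_if_two_colors:
  assumes "card {p, q, r, s} = 2" "p \<noteq> q" "q \<noteq> r" "r \<noteq> s"
  shows "p = r" "q = s"
proof -
  have "p = r \<and> q = s"
  proof (rule ccontr)
    assume "\<not> (p = r \<and> q = s)"
    then obtain x y z where "{x, y, z} \<subseteq> {p, q, r, s}" "card {x, y, z} = 3"
    proof (cases "p = r")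
      case True
      with that[of q r s] \<open>\<not> (p = r \<and> q = s)\<close> assms show ?thesis by auto
    next
      case False
      with that[of p q r] assms show ?thesis by auto
    qed
    then show False using card_mono[of "{p, q, r, s}" "{x, y, z}"] assms(1) by simp
  qed
  then show "p = r" "q = s" by simp_all
qed

lemma length_5_conv: "length xs = 5 \<longleftrightarrow> (\<exists>a b c d e. xs = [a, b, c, d, e])"
  by (auto simp: eval_nat_numeral length_Suc_conv)

lemma length_4_conv: "length xs = 4 \<longleftrightarrow> (\<exists>a b c d. xs = [a, b, c, d])"
  by (auto simp: eval_nat_numeral length_Suc_conv)

lemma simple_graph_edgeE:
  assumes "finite_simple_graph G" "e \<in> edges G"
  obtains x y where "e = {x, y}" "x \<noteq> y" "x \<in> verts G" "y \<in> verts G"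
  using assms by (auto simp: finite_simple_graph_def card_2_iff)

lemma simple_graph_edge_ends:
  assumes "finite_simple_graph G" "{x, y} \<in> edges G"
  shows "x \<noteq> y" "x \<in> verts G" "y \<in> verts G"
  using assms by (fastforce simp: finite_simple_graph_def)+

text \<open>A bicolored path of length four under a proper coloring alternates, so its middle vertex
  violates compatibility. A bicolored 4-cycle, walked around once from any vertex, is such a
  walk with equal ends; the same argument applies to it. The sets \<open>pal w\<close> need only contain the
  actual palettes.\<close>

lemma star_edge_coloringI:
  assumes simple: "finite_simple_graph G"
    and range: "\<And>w x. {w, x} \<in> edges G \<Longrightarrow> c {w, x} \<in> {1..k}"
    and pal: "\<And>w x. {w, x} \<in> edges G \<Longrightarrow> c {w, x} \<in> pal w"
    and local: "\<And>w x y. \<lbrakk>{w, x} \<in> edges G; {w, y} \<in> edges G; x \<noteq> y\<rbrakk>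
      \<Longrightarrow> compatible (c {w, x}) (pal x) (c {w, y}) (pal y)"
  shows "star_edge_coloring G k c"
proof -
  have proper: "c {w, x} \<noteq> c {w, y}"
    if "{w, x} \<in> edges G" "{w, y} \<in> edges G" "x \<noteq> y" for w x y
    using local[OF that] by (simp add: compatible_def)
  have middle: "\<not> (c {x, w} \<in> pal y \<and> c {w, y} \<in> pal x)"
    if "{x, w} \<in> edges G" "{w, y} \<in> edges G" "x \<noteq> y" for w x y
    using local[of w x y] that by (auto simp: compatible_def insert_commute)
  have pal': "c {x, w} \<in> pal w" if "{x, w} \<in> edges G" for x w
    using pal[of w x] that by (simp add: insert_commute)
  have "proper_edge_coloring G k c"
    unfolding proper_edge_coloring_def
  proof (intro conjI ballI impI subsetI)
    fix z assume "z \<in> c ` edges G"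
    then show "z \<in> {1..k}"
      using range by (metis image_iff simple simple_graph_edgeE)
  next
    fix e f assume ef: "e \<in> edges G" "f \<in> edges G" "e \<noteq> f \<and> e \<inter> f \<noteq> {}"
    then obtain w where w: "w \<in> e" "w \<in> f" by blast
    obtain x where x: "e = {w, x}" using simple_graph_edgeE[OF simple ef(1)] w(1)
      by (metis insertE insert_commute singletonD)
    obtain y where y: "f = {w, y}" using simple_graph_edgeE[OF simple ef(2)] w(2)
      by (metis insertE insert_commute singletonD)
    show "c e \<noteq> c f" using proper[of w x y] ef x y by auto
  qed
  moreover have "\<not> bicolored c (path_edges xs)" if xs: "is_path G xs" "length xs = 5" for xs
  proof
    assume bi: "bicolored c (path_edges xs)"
    obtain x1 x2 x3 x4 x5 where eq: "xs = [x1, x2, x3, x4, x5]"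
      using xs(2) by (auto simp: length_5_conv)
    have e: "{x1, x2} \<in> edges G" "{x2, x3} \<in> edges G" "{x3, x4} \<in> edges G" "{x4, x5} \<in> edges G"
      and d: "x1 \<noteq> x3" "x2 \<noteq> x4" "x3 \<noteq> x5"
      using xs(1) by (auto simp: is_path_def eq)
    have "card {c {x1, x2}, c {x2, x3}, c {x3, x4}, c {x4, x5}} = 2"
      using bi by (simp add: bicolored_def eq)
    moreover have "c {x1, x2} \<noteq> c {x2, x3}" "c {x2, x3} \<noteq> c {x3, x4}" "c {x3, x4} \<noteq> c {x4, x5}"
      using proper[of x2 x1 x3] proper[of x3 x2 x4] proper[of x4 x3 x5] e d
      by (simp_all add: insert_commute)
    ultimately have "c {x1, x2} = c {x3, x4}" "c {x2, x3} = c {x4, x5}"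
      by (rule alternating_if_two_colors)+
    then show False
      using middle[of x2 x3 x4] pal'[of x1 x2] pal[of x4 x5] e d by simp
  qed
  moreover have "\<not> bicolored c (cycle_edges xs)" if xs: "is_cycle G xs" "length xs = 4" for xs
  proof
    assume bi: "bicolored c (cycle_edges xs)"
    obtain x1 x2 x3 x4 where eq: "xs = [x1, x2, x3, x4]"
      using xs(2) by (auto simp: length_4_conv)
    have e: "{x4, x1} \<in> edges G" "{x1, x2} \<in> edges G" "{x2, x3} \<in> edges G" "{x3, x4} \<in> edges G"
      and d: "x1 \<noteq> x3" "x2 \<noteq> x4"
      using xs(1) by (auto simp: is_cycle_def cycle_edges_def eq)
    have "card {c {x4, x1}, c {x1, x2}, c {x2, x3}, c {x3, x4}} = 2"
      using bi by (simp add: bicolored_def cycle_edges_def eq)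
    moreover have "c {x4, x1} \<noteq> c {x1, x2}" "c {x1, x2} \<noteq> c {x2, x3}" "c {x2, x3} \<noteq> c {x3, x4}"
      using proper[of x1 x4 x2] proper[of x2 x1 x3] proper[of x3 x2 x4] e d
      by (simp_all add: insert_commute)
    ultimately have "c {x4, x1} = c {x2, x3}" "c {x1, x2} = c {x3, x4}"
      by (rule alternating_if_two_colors)+
    then show False
      using middle[of x1 x2 x3] pal'[of x4 x1] pal[of x3 x4] e d by simp
  qed
  ultimately show ?thesis by (simp add: star_edge_coloring_def)
qed

section \<open>Four colors do not suffice around a triangle\<close>

lemma star_edge_coloring_mono:
  assumes "star_edge_coloring G k c" "k \<le> m"
  shows "star_edge_coloring G m c"
  using assms by (fastforce simp: star_edge_coloring_def proper_edge_coloring_def)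

lemma star_color_range:
  assumes "star_edge_coloring G k c" "e \<in> edges G"
  shows "c e \<in> {1..k}"
  using assms by (auto simp: star_edge_coloring_def proper_edge_coloring_def)

lemma star_color_proper:
  assumes "star_edge_coloring G k c" "{w, x} \<in> edges G" "{w, y} \<in> edges G" "x \<noteq> y"
  shows "c {w, x} \<noteq> c {w, y}"
  using assms unfolding star_edge_coloring_def proper_edge_coloring_def
  by (metis doubleton_eq_iff insert_disjoint(1) insertI1)

text \<open>The two star conditions in one: the ends \<open>x1\<close> and \<open>x5\<close> may coincide, in which case the walk
  is a 4-cycle.\<close>

lemma no_alternating_walk:
  assumes simple: "finite_simple_graph G" and star: "star_edge_coloring G k c"
    and e: "{x1, x2} \<in> edges G" "{x2, x3} \<in> edges G" "{x3, x4} \<in> edges G" "{x4, x5} \<in> edges G"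
    and d: "x1 \<noteq> x3" "x2 \<noteq> x4" "x3 \<noteq> x5" "x1 \<noteq> x4" "x2 \<noteq> x5"
    and eq: "c {x1, x2} = c {x3, x4}"
  shows "c {x2, x3} \<noteq> c {x4, x5}"
proof
  assume eq': "c {x2, x3} = c {x4, x5}"
  have ne: "c {x2, x3} \<noteq> c {x3, x4}"
    using star_color_proper[OF star, of x3 x2 x4] e d by (simp add: insert_commute)
  have "x1 \<noteq> x2" "x2 \<noteq> x3" "x3 \<noteq> x4" "x4 \<noteq> x5" and v: "{x1, x2, x3, x4, x5} \<subseteq> verts G"
    using simple_graph_edge_ends[OF simple] e by (blast, blast, blast, blast, blast)
  note d = d this(1-4)
  show False
  proof (cases "x1 = x5")
    case True
    have "is_cycle G [x1, x2, x3, x4]"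
      using e d v True by (auto simp: is_cycle_def cycle_edges_def)
    moreover have "bicolored c (cycle_edges [x1, x2, x3, x4])"
      using eq eq' ne True by (simp add: bicolored_def cycle_edges_def insert_commute)
    ultimately show False using star by (force simp: star_edge_coloring_def)
  next
    case False
    have "is_path G [x1, x2, x3, x4, x5]"
      using e d v False by (auto simp: is_path_def)
    moreover have "bicolored c (path_edges [x1, x2, x3, x4, x5])"
      using eq eq' ne by (simp add: bicolored_def insert_commute)
    ultimately show False using star by (force simp: star_edge_coloring_def)
  qed
qed

text \<open>A pendant edge avoids the colors of the two triangle sides at its vertex, which leaves the
  color of the opposite side and the fourth color. If the pendants at \<open>x\<close> and \<open>y\<close> both had their
  opposite colors, the walk \<open>x', x, z, y, y'\<close> would alternate. Hence at most one pendant misses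
  the fourth color. The outer ends may coincide, as they do in the complete graph on four
  vertices.\<close>

lemma two_pendants_agree:
  assumes simple: "finite_simple_graph G" and star: "star_edge_coloring G 4 c"
    and tri: "{x, y} \<in> edges G" "{y, z} \<in> edges G" "{x, z} \<in> edges G"
    and pend: "{x, x'} \<in> edges G" "{y, y'} \<in> edges G" "{z, z'} \<in> edges G"
    and out: "x' \<notin> {y, z}" "y' \<notin> {x, z}" "z' \<notin> {x, y}"
  shows "c {x, x'} = c {y, y'} \<or> c {y, y'} = c {z, z'} \<or> c {x, x'} = c {z, z'}"
proof -
  note ends = simple_graph_edge_ends[OF simple]
  have d: "x \<noteq> y" "y \<noteq> z" "x \<noteq> z" "x \<noteq> x'" "y \<noteq> y'" "z \<noteq> z'"
    using ends(1) tri pend by blast+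
  note proper = star_color_proper[OF star]
  have "c {x, y} \<noteq> c {y, z}" "c {y, z} \<noteq> c {x, z}" "c {x, y} \<noteq> c {x, z}"
    using proper[of y x z] proper[of z y x] proper[of x y z] tri d
    by (auto simp: insert_commute)
  moreover have "c {x, x'} \<notin> {c {x, y}, c {x, z}}" "c {y, y'} \<notin> {c {x, y}, c {y, z}}"
    "c {z, z'} \<notin> {c {x, z}, c {y, z}}"
    using proper[of x x' y] proper[of x x' z] proper[of y y' x] proper[of y y' z]
      proper[of z z' x] proper[of z z' y] tri pend out
    by (auto simp: insert_commute)
  moreover have "\<not> (c {x, x'} = c {y, z} \<and> c {y, y'} = c {x, z})"
    using no_alternating_walk[OF simple star, of x' x z y y'] tri pend out d
    by (auto simp: insert_commute)
  moreover have "\<not> (c {x, x'} = c {y, z} \<and> c {z, z'} = c {x, y})"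
    using no_alternating_walk[OF simple star, of x' x y z z'] tri pend out d
    by (auto simp: insert_commute)
  moreover have "\<not> (c {y, y'} = c {x, z} \<and> c {z, z'} = c {x, y})"
    using no_alternating_walk[OF simple star, of y' y x z z'] tri pend out d
    by (auto simp: insert_commute)
  moreover have "\<forall>e \<in> {{x, y}, {y, z}, {x, z}, {x, x'}, {y, y'}, {z, z'}}. c e \<in> {1..4}"
    using star_color_range[OF star] tri pend by blast
  then have "\<forall>e \<in> {{x, y}, {y, z}, {x, z}, {x, x'}, {y, y'}, {z, z'}}. c e \<in> {1, 2, 3, 4}"
    by (auto simp: atLeastAtMost_iff)
  ultimately show ?thesis by simp smt
qed

text \<open>\<open>v\<close> plays the outer end of a pendant edge of the triangle \<open>S\<close>; the two neighbors are
  required outside \<open>S\<close> so that they differ from the inner end of that edge.\<close>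

definition branches_outside :: "'a graph \<Rightarrow> 'a set \<Rightarrow> 'a \<Rightarrow> bool" where
  "branches_outside G S v \<longleftrightarrow>
     (\<exists>w1 w2. w1 \<noteq> w2 \<and> {v, w1} \<in> edges G \<and> {v, w2} \<in> edges G \<and> w1 \<notin> S \<and> w2 \<notin> S)"

text \<open>If the pendants at \<open>x\<close> and \<open>y\<close> agree, their color is the one missing from the triangle. The
  walk \<open>x', x, y, y', w\<close> keeps the color of \<open>xy\<close> off the branches at \<open>y'\<close>, so one of them has the
  color of \<open>yz\<close>. The walk from that branch to \<open>z'\<close> then keeps the fourth color off \<open>zz'\<close>, which
  must have the color of \<open>xy\<close>. Now alternating walks into the triangle keep both colors \<open>yz\<close> and
  \<open>xz\<close> off the branches at \<open>z'\<close>, so both branches have the fourth color.\<close>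

lemma pendants_differ:
  assumes simple: "finite_simple_graph G" and star: "star_edge_coloring G 4 c"
    and tri: "{x, y} \<in> edges G" "{y, z} \<in> edges G" "{x, z} \<in> edges G"
    and pend: "{x, x'} \<in> edges G" "{y, y'} \<in> edges G" "{z, z'} \<in> edges G"
    and out: "x' \<notin> {x, y, z}" "y' \<notin> {x, y, z}" "z' \<notin> {x, y, z}"
    and dist: "y' \<noteq> z'"
    and br: "branches_outside G {x, y, z} y'" "branches_outside G {x, y, z} z'"
  shows "c {x, x'} \<noteq> c {y, y'}"
proof
  assume eq: "c {x, x'} = c {y, y'}"
  note proper = star_color_proper[OF star]
  have d: "x \<noteq> y" "y \<noteq> z" "x \<noteq> z"
    using simple_graph_edge_ends(1)[OF simple] tri by blast+
  have triangle: "c {x, y} \<noteq> c {y, z}" "c {y, z} \<noteq> c {x, z}" "c {x, y} \<noteq> c {x, z}"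
    using proper[of y x z] proper[of z y x] proper[of x y z] tri d
    by (auto simp: insert_commute)
  have pendant: "c {y, y'} \<noteq> c {x, y}" "c {y, y'} \<noteq> c {x, z}" "c {y, y'} \<noteq> c {y, z}"
    "c {z, z'} \<noteq> c {x, z}" "c {z, z'} \<noteq> c {y, z}"
    using proper[of x x' y] proper[of x x' z] proper[of y y' z]
      proper[of z z' x] proper[of z z' y] tri pend out eq
    by (auto simp: insert_commute)
  \<comment> \<open>Needed for the walk \<open>x', x, y, y', w\<close>; a common end would break properness there.\<close>
  have "x' \<noteq> y'"
    using proper[of x' x y] pend d eq by (auto simp: insert_commute)
  have y'_color: "c {y', w} \<in> {c {x, z}, c {y, z}}"
    if w: "{y', w} \<in> edges G" "w \<notin> {x, y, z}" for w
  proof -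
    have "c {x, y} \<noteq> c {y', w}"
      using no_alternating_walk[OF simple star, of x' x y y' w] tri pend out w eq \<open>x' \<noteq> y'\<close>
      by (auto simp: insert_commute)
    moreover have "c {y', w} \<noteq> c {y, y'}"
      using proper[of y' w y] pend w by (auto simp: insert_commute)
    moreover have "\<forall>e \<in> {{x, y}, {y, z}, {x, z}, {y, y'}, {y', w}}. c e \<in> {1..4}"
      using star_color_range[OF star] tri pend w by blast
    then have "\<forall>e \<in> {{x, y}, {y, z}, {x, z}, {y, y'}, {y', w}}. c e \<in> {1, 2, 3, 4}"
      by auto
    ultimately show ?thesis using triangle pendant by simp smt
  qed
  obtain w1 w2 where w: "w1 \<noteq> w2" "{y', w1} \<in> edges G" "{y', w2} \<in> edges G"
    "w1 \<notin> {x, y, z}" "w2 \<notin> {x, y, z}"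
    using br(1) by (auto simp: branches_outside_def)
  have "c {y', w1} \<noteq> c {y', w2}"
    using proper w by blast
  then obtain w where w: "{y', w} \<in> edges G" "w \<notin> {x, y, z}" "c {y', w} = c {y, z}"
    using y'_color[of w1] y'_color[of w2] w by auto
  have "c {y, y'} \<noteq> c {z, z'}"
    using no_alternating_walk[OF simple star, of w y' y z z'] tri pend out w dist d
    by (auto simp: insert_commute)
  have z'_color: "c {z', w} = c {y, y'}"
    if w: "{z', w} \<in> edges G" "w \<notin> {x, y, z}" for w
  proof -
    have *: "\<forall>e \<in> {{x, y}, {y, z}, {x, z}, {y, y'}, {z, z'}, {z', w}}. c e \<in> {1..4}"
      using star_color_range[OF star] tri pend w by blast
    have *: "\<forall>e \<in> {{x, y}, {y, z}, {x, z}, {y, y'}, {z, z'}, {z', w}}. c e \<in> {1, 2, 3, 4}"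
      using * by auto
    have zz': "c {z, z'} = c {x, y}"
      using * triangle pendant \<open>c {y, y'} \<noteq> c {z, z'}\<close> by simp smt
    have "c {z', w} \<noteq> c {y, z}"
      using no_alternating_walk[OF simple star, of w z' z y x] tri pend out w d zz'
      by (auto simp: insert_commute)
    moreover have "c {z', w} \<noteq> c {x, z}"
      using no_alternating_walk[OF simple star, of w z' z x y] tri pend out w d zz'
      by (auto simp: insert_commute)
    moreover have "c {z', w} \<noteq> c {z, z'}"
      using proper[of z' w z] pend w by (auto simp: insert_commute)
    ultimately show ?thesis using * triangle pendant zz' by simp smt
  qed
  obtain v1 v2 where "v1 \<noteq> v2" "{z', v1} \<in> edges G" "{z', v2} \<in> edges G"
    "v1 \<notin> {x, y, z}" "v2 \<notin> {x, y, z}"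
    using br(2) by (auto simp: branches_outside_def)
  then show False
    using z'_color[of v1] z'_color[of v2] proper[of z' v1 v2] by auto
qed

lemma no_star_4_coloring_of_branching_triangle:
  assumes simple: "finite_simple_graph G"
    and tri: "{x, y} \<in> edges G" "{y, z} \<in> edges G" "{x, z} \<in> edges G"
    and pend: "{x, x'} \<in> edges G" "{y, y'} \<in> edges G" "{z, z'} \<in> edges G"
    and out: "x' \<notin> {x, y, z}" "y' \<notin> {x, y, z}" "z' \<notin> {x, y, z}"
    and dist: "x' \<noteq> y'" "y' \<noteq> z'" "x' \<noteq> z'"
    and br: "branches_outside G {x, y, z} x'" "branches_outside G {x, y, z} y'"
      "branches_outside G {x, y, z} z'"
  shows "\<not> star_edge_coloring G 4 c"
proof
  assume star: "star_edge_coloring G 4 c"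
  have "c {x, x'} \<noteq> c {y, y'}"
    using pendants_differ[OF simple star, of x y z x' y' z'] assms by simp
  moreover have "c {y, y'} \<noteq> c {z, z'}"
    using pendants_differ[OF simple star, of y z x y' z' x'] assms by (simp add: insert_commute)
  moreover have "c {x, x'} \<noteq> c {z, z'}"
    using pendants_differ[OF simple star, of x z y x' z' y'] assms by (simp add: insert_commute)
  ultimately show False
    using two_pendants_agree[OF simple star, of x y z x' y' z'] assms by simp
qed

section \<open>The necklace as a ladder with folded ends\<close>

lemma necklace_edges:
  "edges (necklace h) =
    {{V i, V (Suc i)} | i. 1 \<le> i \<and> i < h} \<union> {{U i, V i} | i. 1 \<le> i \<and> i \<le> h} \<union>
    {{U 0, V 1}, {U (Suc h), V h}} \<union> {{U i, U (Suc i)} | i. i \<le> h} \<union> {{U 0, U (Suc h)}}"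
  by (simp add: necklace_def insert_commute)

lemma necklace_edgesI:
  "i \<le> h \<Longrightarrow> {U i, U (Suc i)} \<in> edges (necklace h)"
  "1 \<le> i \<Longrightarrow> i < h \<Longrightarrow> {V i, V (Suc i)} \<in> edges (necklace h)"
  "1 \<le> i \<Longrightarrow> i \<le> h \<Longrightarrow> {U i, V i} \<in> edges (necklace h)"
  "{U 0, V 1} \<in> edges (necklace h)"
  "{U (Suc h), V h} \<in> edges (necklace h)"
  "{U 0, U (Suc h)} \<in> edges (necklace h)"
  unfolding necklace_edges by blast+

lemma necklace_no_star_4_coloring:
  assumes "h \<ge> 1"
  shows "\<not> star_edge_coloring (necklace h) 4 c"
proof
  assume star: "star_edge_coloring (necklace h) 4 c"
  note simple = necklace_finite_simple[OF assms]
  note I = necklace_edgesI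
  have tri: "{U 0, U 1} \<in> edges (necklace h)" "{U 1, V 1} \<in> edges (necklace h)"
    "{U 0, V 1} \<in> edges (necklace h)"
    using I(1)[of 0 h] I(3)[of 1 h] I(4)[of h] assms by simp_all
  have pend: "{U 0, U (Suc h)} \<in> edges (necklace h)" "{U 1, U 2} \<in> edges (necklace h)"
    using I(1)[of 1 h] I(6)[of h] assms by (simp_all add: numeral_2_eq_2)
  show False
  proof (cases "h = 1")
    case True
    have "{V 1, U 2} \<in> edges (necklace h)"
      using I(5)[of h] True by (simp add: insert_commute numeral_2_eq_2)
    with pend show False
      using two_pendants_agree[OF simple star tri pend, of "U 2"] True
        star_color_proper[OF star, of "U 2" "U 0" "U 1"]
        star_color_proper[OF star, of "U 2" "U 1" "V 1"]
        star_color_proper[OF star, of "U 2" "U 0" "V 1"]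
      by (auto simp: insert_commute numeral_2_eq_2)
  next
    case False
    then have h: "h \<ge> 2" using assms by simp
    have pend3: "{V 1, V 2} \<in> edges (necklace h)"
      using I(2)[of 1 h] h by (simp add: numeral_2_eq_2)
    let ?T = "{U 0, U 1, V 1}"
    have "branches_outside (necklace h) ?T (U (Suc h))"
      unfolding branches_outside_def using I(1)[of h h] I(5)[of h] h
      by (intro exI[of _ "U h"] exI[of _ "V h"]) (simp add: insert_commute)
    moreover have "branches_outside (necklace h) ?T (U 2)"
      unfolding branches_outside_def using I(1)[of 2 h] I(3)[of 2 h] h
      by (intro exI[of _ "U 3"] exI[of _ "V 2"]) simp
    moreover have "branches_outside (necklace h) ?T (V 2)"
    proof (cases "h = 2")
      case True
      then show ?thesis
        unfolding branches_outside_def using I(5)[of h] I(3)[of 2 h]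
        by (intro exI[of _ "U 3"] exI[of _ "U 2"]) (simp add: insert_commute)
    next
      case False
      then show ?thesis
        unfolding branches_outside_def using I(2)[of 2 h] I(3)[of 2 h] h
        by (intro exI[of _ "V 3"] exI[of _ "U 2"]) (simp add: insert_commute)
    qed
    ultimately show False
      using no_star_4_coloring_of_branching_triangle[OF simple tri pend pend3] star h by simp
  qed
qed

text \<open>Column \<open>i\<close> holds the colors of the two rail edges between positions \<open>i - 1\<close> and \<open>i\<close> and of
  the rung at position \<open>i\<close>. Positions run from \<open>0\<close> to \<open>h + 1\<close>. At the end positions both rails
  meet in one vertex, and the edge \<open>u\<^sub>0u\<^sub>h\<^sub>+\<^sub>1\<close> is the rung at each of them. Beyond an end each rail
  is continued by the other one (columns \<open>0\<close> and \<open>h + 2\<close>); with this convention the formulas for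
  palettes hold at the ends as well.\<close>

type_synonym column = "nat \<times> nat \<times> nat"

abbreviation top_rail :: "column \<Rightarrow> nat" where "top_rail \<equiv> fst"
abbreviation rung :: "column \<Rightarrow> nat" where "rung p \<equiv> fst (snd p)"
abbreviation bottom_rail :: "column \<Rightarrow> nat" where "bottom_rail p \<equiv> snd (snd p)"

definition top_palette :: "(nat \<Rightarrow> column) \<Rightarrow> nat \<Rightarrow> nat set" where
  "top_palette C i = {top_rail (C i), rung (C i), top_rail (C (Suc i))}"

definition bottom_palette :: "(nat \<Rightarrow> column) \<Rightarrow> nat \<Rightarrow> nat set" where
  "bottom_palette C i = {bottom_rail (C i), rung (C i), bottom_rail (C (Suc i))}"

text \<open>The local criterion at a vertex of degree three.\<close>

definition fork_ok :: "nat \<Rightarrow> nat set \<Rightarrow> nat \<Rightarrow> nat set \<Rightarrow> nat \<Rightarrow> nat set \<Rightarrow> bool" where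
  "fork_ok p P q Q r R \<longleftrightarrow> compatible p P q Q \<and> compatible q Q r R \<and> compatible p P r R"

text \<open>The constraints at both vertices of the rung at position \<open>i + 1\<close>, the shift making the
  window consist of the columns \<open>i\<close> to \<open>i + 3\<close>.\<close>

definition rung_ok :: "(nat \<Rightarrow> column) \<Rightarrow> nat \<Rightarrow> bool" where
  "rung_ok C i \<longleftrightarrow>
     fork_ok (top_rail (C (Suc i))) (top_palette C i)
       (top_rail (C (Suc (Suc i)))) (top_palette C (Suc (Suc i)))
       (rung (C (Suc i))) (bottom_palette C (Suc i)) \<and>
     fork_ok (bottom_rail (C (Suc i))) (bottom_palette C i)
       (bottom_rail (C (Suc (Suc i)))) (bottom_palette C (Suc (Suc i)))
       (rung (C (Suc i))) (top_palette C (Suc i))"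

text \<open>The folding convention, followed by the constraints at \<open>u\<^sub>0\<close> and at \<open>u\<^sub>h\<^sub>+\<^sub>1\<close>, where the edge
  that joins them connects the two ends of the ladder.\<close>

definition ends_ok :: "nat \<Rightarrow> (nat \<Rightarrow> column) \<Rightarrow> bool" where
  "ends_ok h C \<longleftrightarrow>
     top_rail (C 0) = bottom_rail (C 1) \<and> bottom_rail (C 0) = top_rail (C 1) \<and>
     top_rail (C (h + 2)) = bottom_rail (C (h + 1)) \<and>
     bottom_rail (C (h + 2)) = top_rail (C (h + 1)) \<and>
     rung (C (h + 1)) = rung (C 0) \<and>
     fork_ok (top_rail (C 1)) (top_palette C 1) (bottom_rail (C 1)) (bottom_palette C 1)
       (rung (C 0)) (top_palette C (h + 1)) \<and>
     fork_ok (top_rail (C (h + 1))) (top_palette C h)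
       (bottom_rail (C (h + 1))) (bottom_palette C h) (rung (C 0)) (top_palette C 0)"

definition ladder_ok :: "nat \<Rightarrow> (nat \<Rightarrow> column) \<Rightarrow> bool" where
  "ladder_ok h C \<longleftrightarrow>
     (\<forall>i \<le> h + 1. top_rail (C i) \<in> {1..5} \<and> rung (C i) \<in> {1..5} \<and> bottom_rail (C i) \<in> {1..5}) \<and>
     (\<forall>i < h. rung_ok C i) \<and> ends_ok h C"

fun position :: "necklace_vertex \<Rightarrow> nat" where
  "position (U i) = i" | "position (V i) = i"

text \<open>Every edge but \<open>u\<^sub>0u\<^sub>h\<^sub>+\<^sub>1\<close> spans at most two adjacent positions, and a rail edge is stored at
  the larger one.\<close>

definition ladder_coloring :: "nat \<Rightarrow> (nat \<Rightarrow> column) \<Rightarrow> necklace_vertex set \<Rightarrow> nat" where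
  "ladder_coloring h C e =
    (let m = Max (position ` e) in
     if e = {U 0, U (Suc h)} \<or> position ` e = {m} then rung (C m)
     else if e \<subseteq> range U then top_rail (C m) else bottom_rail (C m))"

fun palette :: "(nat \<Rightarrow> column) \<Rightarrow> necklace_vertex \<Rightarrow> nat set" where
  "palette C (U i) = top_palette C i" | "palette C (V i) = bottom_palette C i"

text \<open>The bottom rail shares its end vertices with the top rail.\<close>

definition bottom :: "nat \<Rightarrow> nat \<Rightarrow> necklace_vertex" where
  "bottom h i = (if i = 0 \<or> i = Suc h then U i else V i)"

lemma ladder_coloring_simps:
  assumes "h \<ge> 1" "rung (C (Suc h)) = rung (C 0)"
  shows "i \<le> h \<Longrightarrow> ladder_coloring h C {U i, U (Suc i)} = top_rail (C (Suc i))"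
    and "i \<le> h \<Longrightarrow> ladder_coloring h C {bottom h i, bottom h (Suc i)} = bottom_rail (C (Suc i))"
    and "ladder_coloring h C {U i, V i} = rung (C i)"
    and "ladder_coloring h C {U 0, U (Suc h)} = rung (C 0)"
  using assms
  by (auto simp: ladder_coloring_def Let_def bottom_def doubleton_eq_iff)

lemma necklace_edge_cases:
  assumes "e \<in> edges (necklace h)" "h \<ge> 1"
  obtains (top) i where "i \<le> h" "e = {U i, U (Suc i)}"
    | (bottom) i where "i \<le> h" "e = {bottom h i, bottom h (Suc i)}"
    | (rung) i where "1 \<le> i" "i \<le> h" "e = {U i, V i}"
    | (closing) "e = {U 0, U (Suc h)}"
proof -
  consider (1) i where "1 \<le> i" "i < h" "e = {V i, V (Suc i)}"
    | (2) i where "1 \<le> i" "i \<le> h" "e = {U i, V i}"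
    | (3) "e = {U 0, V 1}" | (4) "e = {U (Suc h), V h}"
    | (5) i where "i \<le> h" "e = {U i, U (Suc i)}" | (6) "e = {U 0, U (Suc h)}"
    using assms(1) unfolding necklace_edges by blast
  then show ?thesis
  proof cases
    case (1 i) then show ?thesis using that(2)[of i] by (simp add: bottom_def)
  next
    case 3 then show ?thesis using that(2)[of 0] assms(2) by (simp add: bottom_def)
  next
    case 4 then show ?thesis using that(2)[of h] assms(2) by (simp add: bottom_def insert_commute)
  qed (use that in blast)+
qed

lemma necklace_neighbours:
  shows "{U 0, x} \<in> edges (necklace h) \<Longrightarrow> x \<in> {U 1, V 1, U (Suc h)}"
    and "{U (Suc h), x} \<in> edges (necklace h) \<Longrightarrow> x \<in> {U h, V h, U 0}"
    and "j < h \<Longrightarrow> {U (Suc j), x} \<in> edges (necklace h) \<Longrightarrow> x \<in> {U j, U (Suc (Suc j)), V (Suc j)}"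
    and "j < h \<Longrightarrow> {V (Suc j), x} \<in> edges (necklace h) \<Longrightarrow>
      x \<in> {bottom h j, bottom h (Suc (Suc j)), U (Suc j)}"
proof -
  show "{U 0, x} \<in> edges (necklace h) \<Longrightarrow> x \<in> {U 1, V 1, U (Suc h)}"
    unfolding necklace_edges by (auto simp: doubleton_eq_iff)
  show "{U (Suc h), x} \<in> edges (necklace h) \<Longrightarrow> x \<in> {U h, V h, U 0}"
    unfolding necklace_edges by (auto simp: doubleton_eq_iff)
  show "j < h \<Longrightarrow> {U (Suc j), x} \<in> edges (necklace h) \<Longrightarrow> x \<in> {U j, U (Suc (Suc j)), V (Suc j)}"
    unfolding necklace_edges by (auto simp: doubleton_eq_iff)
  show "j < h \<Longrightarrow> {V (Suc j), x} \<in> edges (necklace h) \<Longrightarrow>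
      x \<in> {bottom h j, bottom h (Suc (Suc j)), U (Suc j)}"
    unfolding necklace_edges by (auto simp: doubleton_eq_iff bottom_def)
qed

lemma fork_ok_compatible:
  assumes "fork_ok (f x) (P x) (f y) (P y) (f z) (P z)" "u \<in> {x, y, z}" "v \<in> {x, y, z}" "u \<noteq> v"
  shows "compatible (f u) (P u) (f v) (P v)"
  using assms by (auto simp: fork_ok_def intro: compatible_sym)

lemma star_edge_coloring_ladder:
  assumes h: "h \<ge> 1" and ok: "ladder_ok h C"
  shows "star_edge_coloring (necklace h) 5 (ladder_coloring h C)"
proof -
  let ?c = "ladder_coloring h C"
  have colors: "top_rail (C i) \<in> {1..5}" "rung (C i) \<in> {1..5}" "bottom_rail (C i) \<in> {1..5}"
    if "i \<le> Suc h" for i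
    using ok that by (auto simp: ladder_ok_def)
  have inner: "rung_ok C i" if "i < h" for i
    using ok that by (auto simp: ladder_ok_def)
  have ends: "ends_ok h C"
    using ok by (simp add: ladder_ok_def)
  have fold: "rung (C (Suc h)) = rung (C 0)"
    "top_rail (C 0) = bottom_rail (C 1)" "bottom_rail (C 0) = top_rail (C 1)"
    "top_rail (C (Suc (Suc h))) = bottom_rail (C (Suc h))"
    "bottom_rail (C (Suc (Suc h))) = top_rail (C (Suc h))"
    using ends by (simp_all add: ends_ok_def)
  note c = ladder_coloring_simps[where h = h and C = C, OF h fold(1)]
  have palette_bottom: "palette C (bottom h i) = bottom_palette C i" for i
    using fold by (auto simp: bottom_def top_palette_def bottom_palette_def)
  have color_in_palette: "?c e \<in> palette C w" if "e \<in> edges (necklace h)" "w \<in> e" for e w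
    using that(1) h
  proof (cases rule: necklace_edge_cases)
    case (top i)
    then show ?thesis using that(2) by (auto simp: c top_palette_def)
  next
    case (bottom i)
    then show ?thesis using that(2) by (auto simp: c palette_bottom) (auto simp: bottom_palette_def)
  next
    case (rung i)
    then show ?thesis using that(2) by (auto simp: c top_palette_def bottom_palette_def)
  next
    case closing
    then show ?thesis using that(2) fold(1) by (auto simp: c top_palette_def)
  qed
  have fork: "\<exists>x y z. (\<forall>u. {w, u} \<in> edges (necklace h) \<longrightarrow> u \<in> {x, y, z}) \<and>
      fork_ok (?c {w, x}) (palette C x) (?c {w, y}) (palette C y) (?c {w, z}) (palette C z)"
    if "w \<in> verts (necklace h)" for w
  proof -
    consider "w = U 0" | "w = U (Suc h)" | j where "j < h" "w = U (Suc j)"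
      | j where "j < h" "w = V (Suc j)"
    proof -
      have "(\<exists>i \<le> Suc h. w = U i) \<or> (\<exists>i. 1 \<le> i \<and> i \<le> h \<and> w = V i)"
        using \<open>w \<in> verts (necklace h)\<close> by (auto simp: necklace_def)
      then show ?thesis
      proof (elim disjE exE conjE)
        fix i assume i: "i \<le> Suc h" "w = U i"
        then show ?thesis
          using that by (cases i) (auto simp: le_less)
      next
        fix i assume i: "1 \<le> i" "i \<le> h" "w = V i"
        then show ?thesis using that by (cases i) auto
      qed
    qed
    then show ?thesis
    proof cases
      case 1
      have "?c {w, U 1} = top_rail (C 1)" "?c {w, V 1} = bottom_rail (C 1)"
        "?c {w, U (Suc h)} = rung (C 0)"
        using c(1)[of 0] c(2)[of 0] c(4) 1 h by (simp_all add: bottom_def)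
      then show ?thesis
        using ends necklace_neighbours(1)[where h = h] 1
        by (intro exI[of _ "U 1"] exI[of _ "V 1"] exI[of _ "U (Suc h)"]) (auto simp: ends_ok_def)
    next
      case 2
      have "?c {w, U h} = top_rail (C (Suc h))" "?c {w, V h} = bottom_rail (C (Suc h))"
        "?c {w, U 0} = rung (C 0)"
        using c(1)[of h] c(2)[of h] c(4) 2 h by (simp_all add: bottom_def insert_commute)
      then show ?thesis
        using ends necklace_neighbours(2)[where h = h] 2
        by (intro exI[of _ "U h"] exI[of _ "V h"] exI[of _ "U 0"]) (auto simp: ends_ok_def)
    next
      case (3 j)
      have "?c {w, U j} = top_rail (C (Suc j))" "?c {w, V (Suc j)} = rung (C (Suc j))"
        "?c {w, U (Suc (Suc j))} = top_rail (C (Suc (Suc j)))"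
        using c(1)[of j] c(1)[of "Suc j"] c(3)[of "Suc j"] 3 by (simp_all add: insert_commute)
      then show ?thesis
        using inner[of j] necklace_neighbours(3)[where h = h] 3
        by (intro exI[of _ "U j"] exI[of _ "U (Suc (Suc j))"] exI[of _ "V (Suc j)"])
          (auto simp: rung_ok_def)
    next
      case (4 j)
      have w: "w = bottom h (Suc j)"
        using 4 by (simp add: bottom_def)
      have "?c {w, bottom h j} = bottom_rail (C (Suc j))" "?c {w, U (Suc j)} = rung (C (Suc j))"
        "?c {w, bottom h (Suc (Suc j))} = bottom_rail (C (Suc (Suc j)))"
        using c(2)[of j] c(2)[of "Suc j"] c(3)[of "Suc j"] 4
        by (simp_all add: insert_commute flip: w)
      then show ?thesis
        using inner[of j] necklace_neighbours(4)[where h = h] 4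
        by (intro exI[of _ "bottom h j"] exI[of _ "bottom h (Suc (Suc j))"] exI[of _ "U (Suc j)"])
          (auto simp: rung_ok_def palette_bottom)
    qed
  qed
  show ?thesis
  proof (rule star_edge_coloringI[OF necklace_finite_simple[OF h], where pal = "palette C"])
    show "?c {w, x} \<in> {1..5}" if "{w, x} \<in> edges (necklace h)" for w x
      using that h
    proof (cases rule: necklace_edge_cases)
      case (top i)
      then show ?thesis using colors(1)[of "Suc i"] c(1)[of i] by simp
    next
      case (bottom i)
      then show ?thesis using colors(3)[of "Suc i"] c(2)[of i] by simp
    next
      case (rung i)
      then show ?thesis using colors(2)[of i] c(3)[of i] by simp
    next
      case closing
      then show ?thesis using colors(2)[of 0] c(4) by simp
    qed
    show "?c {w, x} \<in> palette C w" if "{w, x} \<in> edges (necklace h)" for w x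
      using color_in_palette that by blast
    fix w x y
    assume e: "{w, x} \<in> edges (necklace h)" "{w, y} \<in> edges (necklace h)" "x \<noteq> y"
    have "w \<in> verts (necklace h)"
      using simple_graph_edge_ends(2)[OF necklace_finite_simple[OF h] e(1)] .
    from fork[OF this] e
    show "compatible (?c {w, x}) (palette C x) (?c {w, y}) (palette C y)"
      using fork_ok_compatible[of "\<lambda>u. ?c {w, u}" _ "palette C"] by meson
  qed
qed

section \<open>Colorings of period four\<close>

text \<open>Bounded quantifiers as traversals of index lists, so that rewriting alone decides
  \<^const>\<open>ladder_ok\<close> for an explicit list of columns.\<close>

lemma ladder_ok_iff_list_all:
  "ladder_ok h C \<longleftrightarrow>
     list_all (\<lambda>i. \<forall>p \<in> {top_rail (C i), rung (C i), bottom_rail (C i)}. 1 \<le> p \<and> p \<le> 5)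
       [0..<h + 2] \<and>
     list_all (rung_ok C) [0..<h] \<and> ends_ok h C"
  by (auto simp: ladder_ok_def list_all_iff less_Suc_eq_le simp del: upt_Suc)

lemmas ladder_ok_check = ladder_ok_iff_list_all upt_rec[of _ "numeral k" for k]
  rung_ok_def ends_ok_def fork_ok_def compatible_def top_palette_def bottom_palette_def

text \<open>Each list below has one column per position \<open>0, \<dots>, h + 1\<close> and a last column for the
  folded rails at the right end. That column has no rung; its entry \<open>0\<close> is a placeholder.\<close>

lemma ladder_ok_1: "ladder_ok 1 ((!) [(3,1,2), (2,1,3), (4,1,5), (5,0,4)])"
  by (simp add: ladder_ok_check)

lemma ladder_ok_3: "ladder_ok 3 ((!) [(3,1,2), (2,5,3), (1,5,4), (3,1,2), (4,1,5), (5,0,4)])"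
  by (simp add: ladder_ok_check)

lemma ladder_ok_4: "ladder_ok 4 ((!) [(3,1,2), (2,5,3), (1,5,4), (3,1,2), (2,3,4), (4,1,5), (5,0,4)])"
  by (simp add: ladder_ok_check)

lemma ladder_ok_5: "ladder_ok 5 ((!) [(3,1,2), (2,5,3), (1,5,4), (3,1,2), (4,1,5), (2,1,3),
    (4,1,5), (5,0,4)])"
  by (simp add: ladder_ok_check)

lemma ladder_ok_6: "ladder_ok 6 ((!) [(3,1,2), (2,5,3), (1,5,4), (3,1,2), (4,3,5), (5,2,1),
    (1,3,4), (4,1,5), (5,0,4)])"
  by (simp add: ladder_ok_check)

text \<open>The columns at positions 1 to 3 begin the period
  \<open>(2,5,3), (1,5,4), (3,1,2), (4,1,5)\<close>. A constraint at a position sees no more than four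
  consecutive columns, and of the fourth only the rails. So these three columns are all that a
  copy of the period placed in front of them has to fit.\<close>

definition starts_with_block :: "(nat \<Rightarrow> column) \<Rightarrow> bool" where
  "starts_with_block C \<longleftrightarrow> C 0 = (3,1,2) \<and> C 1 = (2,5,3) \<and> C 2 = (1,5,4) \<and> C 3 = (3,1,2)"

text \<open>Column 0 describes the left end of the ladder, so the new period enters after it. The first
  five columns can be given outright because column 0 is fixed, too.\<close>

definition insert_block :: "(nat \<Rightarrow> column) \<Rightarrow> nat \<Rightarrow> column" where
  "insert_block C i =
     (if i \<le> 4 then [(3,1,2), (2,5,3), (1,5,4), (3,1,2), (4,1,5)] ! i else C (i - 4))"

lemma starts_with_insert_block: "starts_with_block (insert_block C)"
  by (simp add: starts_with_block_def insert_block_def)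

text \<open>Windows of four columns that begin after the inserted period are old windows; the five that
  begin earlier are known explicitly. Both ends look as before: the left one because the columns
  0 to 2 are unchanged, the right one because the last three columns are merely shifted.\<close>

lemma ladder_ok_insert_block:
  assumes ok: "ladder_ok h C" and start: "starts_with_block C" and h: "h \<ge> 1"
  shows "ladder_ok (h + 4) (insert_block C)"
proof -
  let ?D = "insert_block C"
  have C: "C 0 = (3,1,2)" "C (Suc 0) = (2,5,3)" "C (Suc (Suc 0)) = (1,5,4)"
    "C (Suc (Suc (Suc 0))) = (3,1,2)"
    using start by (simp_all add: starts_with_block_def numeral_2_eq_2 numeral_3_eq_3)
  have D: "?D 0 = (3,1,2)" "?D (Suc 0) = (2,5,3)" "?D (Suc (Suc 0)) = (1,5,4)"
    "?D (Suc (Suc (Suc 0))) = (3,1,2)" "?D (Suc (Suc (Suc (Suc 0)))) = (4,1,5)"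
    "?D (Suc (Suc (Suc (Suc (Suc i))))) = C (Suc i)" for i
    by (simp_all add: insert_block_def)
  have colors: "top_rail (?D i) \<in> {1..5} \<and> rung (?D i) \<in> {1..5} \<and> bottom_rail (?D i) \<in> {1..5}"
    if "i \<le> h + 4 + 1" for i
  proof (cases "i \<le> 4")
    case True
    then have "i = 0 \<or> i = 1 \<or> i = 2 \<or> i = 3 \<or> i = 4" by auto
    then show ?thesis by (auto simp: insert_block_def)
  next
    case False
    then show ?thesis using ok that by (simp add: insert_block_def ladder_ok_def)
  qed
  have inner: "rung_ok ?D i" if "i < h + 4" for i
  proof -
    consider "i = 0" | "i = Suc 0" | "i = Suc (Suc 0)" | "i = Suc (Suc (Suc 0))"
      | "i = Suc (Suc (Suc (Suc 0)))" | j where "i = Suc (Suc (Suc (Suc (Suc j))))"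
      by (metis not0_implies_Suc)
    then show ?thesis
    proof cases
      case (6 j)
      then have "rung_ok C (Suc j)" using ok that by (simp add: ladder_ok_def)
      then show ?thesis
        unfolding 6 by (simp add: rung_ok_def top_palette_def bottom_palette_def D)
    qed (simp_all add: rung_ok_def fork_ok_def compatible_def top_palette_def bottom_palette_def C D)
  qed
  have "ends_ok (h + 4) ?D"
  proof -
    have last: "?D (h + 4) = C h" "?D (h + 4 + 1) = C (h + 1)" "?D (h + 4 + 2) = C (h + 2)"
      using h by (simp_all add: insert_block_def)
    have "top_palette ?D (h + 4) = top_palette C h"
      "bottom_palette ?D (h + 4) = bottom_palette C h"
      "top_palette ?D (h + 4 + 1) = top_palette C (h + 1)"
      using last by (simp_all add: top_palette_def bottom_palette_def)
    moreover have "top_palette ?D 0 = top_palette C 0" "top_palette ?D 1 = top_palette C 1"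
      "bottom_palette ?D 1 = bottom_palette C 1" "?D 0 = C 0" "?D 1 = C 1"
      by (simp_all add: top_palette_def bottom_palette_def C D)
    ultimately show ?thesis
      using ok last unfolding ladder_ok_def ends_ok_def by metis
  qed
  with colors inner show ?thesis by (simp add: ladder_ok_def)
qed

text \<open>Insertion of a period adds 4 to \<open>h\<close>, so one coloring per residue class suffices.\<close>

lemma ladder_ok_exists_ge_3:
  "h \<ge> 3 \<Longrightarrow> \<exists>C. ladder_ok h C \<and> starts_with_block C"
proof (induction h rule: less_induct)
  case (less h)
  consider "h = 3" | "h = 4" | "h = 5" | "h = 6" | "h \<ge> 7" using less.prems by linarith
  then show ?case
  proof cases
    case 1
    with ladder_ok_3 show ?thesis by (intro exI conjI) (assumption | simp add: starts_with_block_def)+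
  next
    case 2
    with ladder_ok_4 show ?thesis by (intro exI conjI) (assumption | simp add: starts_with_block_def)+
  next
    case 3
    with ladder_ok_5 show ?thesis by (intro exI conjI) (assumption | simp add: starts_with_block_def)+
  next
    case 4
    with ladder_ok_6 show ?thesis by (intro exI conjI) (assumption | simp add: starts_with_block_def)+
  next
    case 5
    then have "h - 4 < h" "h - 4 \<ge> 3" by linarith+
    then obtain C where C: "ladder_ok (h - 4) C" "starts_with_block C"
      using less.IH by blast
    have "ladder_ok h (insert_block C)"
      using ladder_ok_insert_block[OF C] \<open>h - 4 \<ge> 3\<close> 5 by simp
    then show ?thesis using starts_with_insert_block by blast
  qed
qed

theorem corollary4p2:
  fixes h :: nat
  assumes "h \<ge> 1" and "h \<noteq> 2"
  shows "star_chromatic_index (necklace h) = 5"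
  unfolding star_chromatic_index_def
proof (rule Least_equality)
  have "\<exists>C. ladder_ok h C"
  proof (cases "h = 1")
    case True
    then show ?thesis using ladder_ok_1 by blast
  next
    case False
    then show ?thesis using ladder_ok_exists_ge_3[of h] assms by force
  qed
  then show "1 \<le> (5::nat) \<and> (\<exists>c. star_edge_coloring (necklace h) 5 c)"
    using star_edge_coloring_ladder assms(1) by auto
next
  fix k :: nat assume "1 \<le> k \<and> (\<exists>c. star_edge_coloring (necklace h) k c)"
  then obtain c where "star_edge_coloring (necklace h) k c" by blast
  then have "\<not> k \<le> 4"
    using star_edge_coloring_mono[of _ k c 4] necklace_no_star_4_coloring[OF assms(1)] by blast
  then show "5 \<le> k" by simp
qed

end
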